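(* Any $\ell_2/\ell_2$ sparse recovery scheme that uses at most $b$ bits in each entry of its measurement matrix $\Phi$ needs at least $\Omega\!\left(\sqrt{\frac{s}{b}}\right)$ measurements (rows of $\Phi$) to be successful against an $s$-information-theoretically-bounded adversary.
   Context: An $\ell_2/\ell_2$ sparse recovery scheme for signals in $\mathbb{R}^N$ consists of a (possibly random) $m\times N$ measurement matrix $\Phi$ and a decoding algorithm $A$; $m$ is the number of measurements. Its error guarantee on a signal $\mathbf{x}\in\mathbb{R}^N$ is $\|\mathbf{x}-A(\Phi\mathbf{x})\|_2\le C\|\mathbf{x}-\mathbf{x}_k\|_2$, where $\mathbf{x}_k$ is the best $k$-sparse approximation of $\mathbf{x}$ and the approximation factor $C$ is a constant. An adversary is the process that generates the input signal, possibly depending on $\Phi$. It is $s$-information-theoretically-bounded if it has the form $M=M_2\circ M_1$, i.e. the signal is $M_2(M_1(\Phi))$, where the output of $M_1$ consists of at most $s$ bits. Being successful against such an adversary means that the output of the decoding algorithm meets the $\ell_2/\ell_2$ error guarantee on the signal the adversary generates.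
   Formalization: Assumes √(s/b) ≤ N, since otherwise the N×N identity matrix (m = N, 1-bit entries) succeeds against every adversary however large s is; also assumes sparsity k ≥ 1 and b ≥ 1 to exclude trivial cases. *)

theory Defs
  imports "HOL-Probability.Probability" "Jordan_Normal_Form.Matrix"
begin

no_notation vec_nth (infixl "$" 90)
hide_type (open) Finite_Cartesian_Product.vec
hide_const (open) Finite_Cartesian_Product.vec

text \<open>The dimensions \<open>m\<close> and \<open>N\<close> occur under the constant hidden in an \<open>\<Omega>\<close>, so they must be
  ordinary numbers and not types: signals and matrices are dimension-carrying vectors and
  matrices.\<close>

definition l2_norm :: "real vec \<Rightarrow> real" where
  "l2_norm x = L2_set (\<lambda>i. x $ i) {..<dim_vec x}"

definition sparse :: "nat \<Rightarrow> real vec \<Rightarrow> bool" where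
  "sparse k x \<longleftrightarrow> card {i. i < dim_vec x \<and> x $ i \<noteq> 0} \<le> k"

text \<open>Best approximations need not be unique, because of ties between entries of equal magnitude,
  but all of them have the same distance to \<open>x\<close>.\<close>

definition best_sparse_approx :: "nat \<Rightarrow> real vec \<Rightarrow> real vec \<Rightarrow> bool" where
  "best_sparse_approx k x y \<longleftrightarrow>
     y \<in> carrier_vec (dim_vec x) \<and> sparse k y \<and>
     (\<forall>z \<in> carrier_vec (dim_vec x). sparse k z \<longrightarrow> l2_norm (x - y) \<le> l2_norm (x - z))"

definition l2_l2_guarantee :: "real \<Rightarrow> nat \<Rightarrow> real vec \<Rightarrow> real vec \<Rightarrow> bool" where
  "l2_l2_guarantee C k x x' \<longleftrightarrow>
     (\<exists>y. best_sparse_approx k x y \<and> l2_norm (x - x') \<le> C * l2_norm (x - y))"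

text \<open>The random measurement matrix is given by its distribution \<open>P\<close>. A discrete distribution is no
  restriction here: matrices whose entries have at most \<open>b\<close> bits range over a finite set.
  A deterministic matrix is the case \<open>P = return_pmf \<Phi>\<close>. The decoding algorithm \<open>A\<close> may use the
  matrix in addition to the measurements: \<open>A \<Phi> (\<Phi> *\<^sub>v x)\<close> is its output on the signal \<open>x\<close>.\<close>

definition recovery_scheme ::
    "nat \<Rightarrow> nat \<Rightarrow> real mat pmf \<Rightarrow> (real mat \<Rightarrow> real vec \<Rightarrow> real vec) \<Rightarrow> bool" where
  "recovery_scheme m N P A \<longleftrightarrow>
     set_pmf P \<subseteq> carrier_mat m N \<and>
     (\<forall>\<Phi> \<in> carrier_mat m N. \<forall>y \<in> carrier_vec m. A \<Phi> y \<in> carrier_vec N)"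

text \<open>The map \<open>enc\<close> is the number format, which turns bit strings into real numbers; any format is
  allowed.\<close>

definition bits_per_entry :: "nat \<Rightarrow> real mat pmf \<Rightarrow> bool" where
  "bits_per_entry b P \<longleftrightarrow>
     (\<exists>enc :: bool list \<Rightarrow> real. \<forall>\<Phi> \<in> set_pmf P. \<forall>i < dim_row \<Phi>. \<forall>j < dim_col \<Phi>.
        \<exists>w. length w \<le> b \<and> \<Phi> $$ (i, j) = enc w)"

definition info_bounded_adversary ::
    "nat \<Rightarrow> nat \<Rightarrow> nat \<Rightarrow> (real mat \<Rightarrow> real vec) \<Rightarrow> bool" where
  "info_bounded_adversary m N s M \<longleftrightarrow>
     (\<exists>(M1 :: real mat \<Rightarrow> bool list) (M2 :: bool list \<Rightarrow> real vec).
        M = M2 \<circ> M1 \<and>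
        (\<forall>\<Phi> \<in> carrier_mat m N. length (M1 \<Phi>) \<le> s) \<and>
        (\<forall>w. M2 w \<in> carrier_vec N))"

text \<open>Success is meant with probability at least \<open>p\<close> over the choice of the matrix.\<close>

definition successful_against ::
    "real \<Rightarrow> nat \<Rightarrow> real \<Rightarrow> real mat pmf \<Rightarrow> (real mat \<Rightarrow> real vec \<Rightarrow> real vec) \<Rightarrow>
     (real mat \<Rightarrow> real vec) \<Rightarrow> bool" where
  "successful_against C k p P A M \<longleftrightarrow>
     p \<le> measure_pmf.prob P {\<Phi>. l2_l2_guarantee C k (M \<Phi>) (A \<Phi> (\<Phi> *\<^sub>v M \<Phi>))}"

end

theory Submission
  imports Defs
begin

text \<open>Let \<open>n\<close> be \<open>sqrt (s / b)\<close>, rounded up. If \<open>m\<close> is a small multiple of \<open>n\<close>, the first \<open>n\<close> columns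
  of the matrix have about \<open>b m n \<le> s / 2\<close> bits, so the adversary may let its signal depend on them.
  The orthogonal projection onto their kernel has trace at least \<open>n - m\<close>, hence a diagonal entry
  \<open>(j, j)\<close> of size at least \<open>1 - m / n\<close>; its \<open>j\<close>-th column \<open>v\<close> is a kernel vector concentrated in the
  entry \<open>j\<close>. The \<open>1\<close>-sparse signal \<open>v\<^sub>j e\<^sub>j\<close> and the signal \<open>v\<^sub>j e\<^sub>j - v\<close> have the same measurements.
  A decoder that recovers the former has to recover it exactly, and then it has error \<open>\<parallel>v\<parallel>\<close> on the
  latter, which itself has norm at most \<open>sqrt (m / n) \<parallel>v\<parallel>\<close>. One more bit tells which of the two the
  decoder gets wrong.\<close>

section \<open>Orthogonal projections into the kernel of a matrix\<close>

text \<open>\<open>Q\<close> is the matrix of an orthogonal projection of \<open>\<real>\<^sup>n\<close> into the kernel of the \<open>m \<times> n\<close> matrix \<open>a\<close>;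
  the last condition is a lower bound on its rank.\<close>

definition kernel_projection ::
    "nat \<Rightarrow> nat \<Rightarrow> (nat \<Rightarrow> nat \<Rightarrow> real) \<Rightarrow> (nat \<Rightarrow> nat \<Rightarrow> real) \<Rightarrow> bool" where
  "kernel_projection m n a Q \<longleftrightarrow>
     (\<forall>i<n. \<forall>j<n. Q i j = Q j i) \<and>
     (\<forall>i<n. \<forall>j<n. (\<Sum>l<n. Q i l * Q l j) = Q i j) \<and>
     (\<forall>r<m. \<forall>j<n. (\<Sum>l<n. a r l * Q l j) = 0) \<and>
     real n - real m \<le> (\<Sum>i<n. Q i i)"

lemma kernel_projectionI:
  assumes "\<And>i j. i < n \<Longrightarrow> j < n \<Longrightarrow> Q i j = Q j i"
    and "\<And>i j. i < n \<Longrightarrow> j < n \<Longrightarrow> (\<Sum>l<n. Q i l * Q l j) = Q i j"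
    and "\<And>r j. r < m \<Longrightarrow> j < n \<Longrightarrow> (\<Sum>l<n. a r l * Q l j) = 0"
    and "real n - real m \<le> (\<Sum>i<n. Q i i)"
  shows "kernel_projection m n a Q"
  unfolding kernel_projection_def using assms by blast

lemma kernel_projectionD:
  assumes "kernel_projection m n a Q"
  shows "\<And>i j. i < n \<Longrightarrow> j < n \<Longrightarrow> Q i j = Q j i"
    and "\<And>i j. i < n \<Longrightarrow> j < n \<Longrightarrow> (\<Sum>l<n. Q i l * Q l j) = Q i j"
    and "\<And>r j. r < m \<Longrightarrow> j < n \<Longrightarrow> (\<Sum>l<n. a r l * Q l j) = 0"
    and "real n - real m \<le> (\<Sum>i<n. Q i i)"
  using assms unfolding kernel_projection_def by blast+

text \<open>Gram-Schmidt by induction on the rows: the identity serves for no rows, and each new row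
  costs at most one dimension of the range, hence at most 1 of the trace.\<close>

lemma kernel_projection_exists: "\<exists>Q. kernel_projection m n a Q"
proof (induction m)
  case 0
  have "(\<Sum>l<n. (if i = l then 1 else 0) * (if l = j then 1 else 0)) = (if i = j then 1 else (0::real))"
    if "i < n" "j < n" for i j
    using that by (simp add: if_distrib[of "\<lambda>x. x * _"] sum.delta cong: if_cong)
  then show ?case
    by (intro exI[of _ "\<lambda>i j. if i = j then 1 else 0"] kernel_projectionI) auto
next
  case (Suc m)
  then obtain Q where Q: "kernel_projection m n a Q" ..
  note sym = kernel_projectionD(1)[OF Q] and idem = kernel_projectionD(2)[OF Q]
    and ker = kernel_projectionD(3)[OF Q] and tr = kernel_projectionD(4)[OF Q]
  \<comment> \<open>As \<open>Q\<close> is symmetric, \<open>u\<close> is the projection of the new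
    row onto the range of \<open>Q\<close>; \<open>S\<close> is its squared length.\<close>
  define u where "u j = (\<Sum>l<n. a m l * Q l j)" for j
  define S where "S = (\<Sum>l<n. u l * u l)"
  have u_Q: "(\<Sum>l<n. u l * Q l j) = u j" if "j < n" for j
  proof -
    have "(\<Sum>l<n. u l * Q l j) = (\<Sum>l<n. \<Sum>k<n. a m k * (Q k l * Q l j))"
      by (simp add: u_def sum_distrib_right mult.assoc)
    also have "\<dots> = (\<Sum>k<n. a m k * (\<Sum>l<n. Q k l * Q l j))"
      by (subst sum.swap) (simp add: sum_distrib_left)
    also have "\<dots> = u j"
      using that by (simp add: u_def idem)
    finally show ?thesis .
  qed
  have Q_u: "(\<Sum>l<n. Q j l * u l) = u j" if "j < n" for j
    using u_Q[OF that] sym that by (simp add: mult.commute)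
  \<comment> \<open>The inner sum on the right vanishes for the old rows \<open>r < m\<close>. For
    \<open>r = m\<close> it is \<open>u k\<close>, and the whole sum becomes
    \<open>S\<close>.\<close>
  have row_u: "(\<Sum>l<n. a r l * u l) = (\<Sum>k<n. u k * (\<Sum>l<n. a r l * Q l k))" for r
  proof -
    have "(\<Sum>l<n. a r l * u l) = (\<Sum>l<n. \<Sum>k<n. u k * (a r l * Q l k))"
      by (intro sum.cong refl) (simp add: Q_u[symmetric] sum_distrib_left mult_ac)
    also have "\<dots> = (\<Sum>k<n. u k * (\<Sum>l<n. a r l * Q l k))"
      by (subst sum.swap) (simp add: sum_distrib_left)
    finally show ?thesis .
  qed
  show ?case
  proof (cases "S = 0")
    \<comment> \<open>Here the new row already vanishes on the range of \<open>Q\<close>, so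
      \<open>Q\<close> can be kept.\<close>
    case True
    then have "u j = 0" if "j < n" for j
      using that by (simp add: S_def sum_nonneg_eq_0_iff)
    then have "(\<Sum>l<n. a r l * Q l j) = 0" if "r < Suc m" "j < n" for r j
      using that ker by (cases "r = m") (auto simp: u_def)
    then have "kernel_projection (Suc m) n a Q"
      using sym idem tr by (intro kernel_projectionI) auto
    then show ?thesis by (rule exI[of _ Q])
  next
    case False
    \<comment> \<open>The projection onto the orthogonal complement of \<open>u\<close> in the range of \<open>Q\<close>.\<close>
    define R where "R i j = Q i j - u i * u j / S" for i j
    have ru: "(\<Sum>l<n. a r l * R l j) = (\<Sum>l<n. a r l * Q l j) - (\<Sum>l<n. a r l * u l) * u j / S"
      for r j
      by (simp add: R_def algebra_simps sum_subtractf sum_distrib_left sum_divide_distrib)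
    have "(\<Sum>l<n. R i l * R l j) = R i j" if "i < n" "j < n" for i j
    proof -
      have "(\<Sum>l<n. R i l * R l j) = (\<Sum>l<n. Q i l * Q l j - (u j / S) * (Q i l * u l)
          - (u i / S) * (u l * Q l j) + (u i * u j / S / S) * (u l * u l))"
        by (simp add: R_def algebra_simps)
      also have "\<dots> = (\<Sum>l<n. Q i l * Q l j) - (u j / S) * (\<Sum>l<n. Q i l * u l)
          - (u i / S) * (\<Sum>l<n. u l * Q l j) + (u i * u j / S / S) * S"
        unfolding S_def sum.distrib sum_subtractf sum_distrib_left ..
      finally show ?thesis
        using that False by (simp add: idem Q_u u_Q R_def)
    qed
    moreover have "(\<Sum>l<n. a r l * R l j) = 0" if "r < Suc m" "j < n" for r j
    proof (cases "r = m")
      case True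
      have "(\<Sum>l<n. a m l * u l) = S"
        by (simp add: row_u S_def flip: u_def)
      with True False show ?thesis
        by (simp add: ru flip: u_def)
    next
      case False
      with that have "r < m" by simp
      with that show ?thesis
        by (simp add: ru row_u ker)
    qed
    \<comment> \<open>The rank-one term subtracted from \<open>Q\<close> is itself a projection, of
      trace 1.\<close>
    moreover have "(\<Sum>i<n. R i i) = (\<Sum>i<n. Q i i) - 1"
      using False by (simp add: R_def sum_subtractf S_def flip: sum_divide_distrib)
    moreover have "R i j = R j i" if "i < n" "j < n" for i j
      using sym[OF that] by (simp add: R_def mult.commute)
    ultimately have "kernel_projection (Suc m) n a R"
      using tr by (intro kernel_projectionI) auto
    then show ?thesis by (rule exI[of _ R])
  qed
qed

text \<open>By averaging the trace, some diagonal entry \<open>q = Q j j\<close> is at least 1 -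
  m/n. Symmetry and idempotence make \<open>q\<close> the squared norm of column \<open>j\<close>,
  whose entry \<open>j\<close> is also \<open>q\<close>; the other entries contribute q(1 - q), at
  most q m/n.\<close>

lemma concentrated_kernel_vector:
  fixes a :: "nat \<Rightarrow> nat \<Rightarrow> real"
  assumes "m < n"
  shows "\<exists>j<n. \<exists>v. (\<forall>r<m. (\<Sum>l<n. a r l * v l) = 0) \<and> 0 < (\<Sum>l<n. (v l)\<^sup>2) \<and>
     real n * ((\<Sum>l<n. (v l)\<^sup>2) - (v j)\<^sup>2) \<le> real m * (\<Sum>l<n. (v l)\<^sup>2)"
proof -
  obtain Q where Q: "kernel_projection m n a Q"
    using kernel_projection_exists ..
  note sym = kernel_projectionD(1)[OF Q] and idem = kernel_projectionD(2)[OF Q]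
    and ker = kernel_projectionD(3)[OF Q] and tr = kernel_projectionD(4)[OF Q]
  have "\<exists>j<n. real n - real m \<le> real n * Q j j"
  proof (rule ccontr)
    assume "\<not> ?thesis"
    then have "(\<Sum>j<n. real n * Q j j) < (\<Sum>j<n. real n - real m)"
      using assms by (intro sum_strict_mono) auto
    also have "\<dots> \<le> real n * (\<Sum>j<n. Q j j)"
      using tr by (simp add: mult_left_mono)
    finally show False by (simp add: sum_distrib_left)
  qed
  then obtain j where j: "j < n" "real n - real m \<le> real n * Q j j" by blast
  define q where "q = Q j j"
  have q: "(\<Sum>l<n. (Q l j)\<^sup>2) = q"
    using idem[of j j] j sym by (simp add: q_def power2_eq_square)
  have "0 < real n * q" using j assms by (simp add: q_def)
  then have "0 < q" by (simp add: zero_less_mult_iff)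
  moreover have "real n * (q - q\<^sup>2) \<le> real m * q"
  proof -
    have "q * (real n * (1 - q)) \<le> q * real m"
      using j \<open>0 < q\<close> by (intro mult_left_mono) (auto simp: q_def algebra_simps)
    then show ?thesis by (simp add: algebra_simps power2_eq_square)
  qed
  ultimately show ?thesis
    using j(1) ker q by (intro exI[of _ j] conjI exI[of _ "\<lambda>l. Q l j"]) (auto simp: q_def)
qed

section \<open>Two signals with equal measurements\<close>

text \<open>The pair is built from the first \<open>n\<close> columns \<open>D\<close> alone, so it
  serves every matrix that agrees with \<open>D\<close> there. With the kernel vector padded by
  zeros to \<open>w\<close>, \<open>x\<close> is its entry \<open>j\<close> and
  \<open>x' = x - w\<close> is minus the remaining entries, which are small.\<close>

lemma indistinguishable_signals:
  fixes C :: real and D :: "nat \<times> nat \<Rightarrow> real"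
  assumes "0 < C" "m < n" "C\<^sup>2 * real m < real n" "n \<le> N"
  shows "\<exists>x x'. x \<in> carrier_vec N \<and> x' \<in> carrier_vec N \<and> sparse 1 x \<and>
     C * l2_norm x' < l2_norm (x' - x) \<and>
     (\<forall>\<Phi> \<in> carrier_mat m N. (\<forall>i<m. \<forall>j<n. \<Phi> $$ (i, j) = D (i, j)) \<longrightarrow>
        \<Phi> *\<^sub>v x = \<Phi> *\<^sub>v x')"
proof -
  obtain j v where j: "j < n"
    and ker: "\<And>r. r < m \<Longrightarrow> (\<Sum>l<n. D (r, l) * v l) = 0"
    and pos: "0 < (\<Sum>l<n. (v l)\<^sup>2)"
    and conc: "real n * ((\<Sum>l<n. (v l)\<^sup>2) - (v j)\<^sup>2) \<le> real m * (\<Sum>l<n. (v l)\<^sup>2)"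
    using concentrated_kernel_vector[OF assms(2), of "\<lambda>r l. D (r, l)"] by blast
  define V where "V = (\<Sum>l<n. (v l)\<^sup>2)"
  define w where "w = vec N (\<lambda>l. if l < n then v l else 0)"
  define x where "x = vec N (\<lambda>l. if l = j then v j else 0)"
  have [simp]: "w \<in> carrier_vec N" "x \<in> carrier_vec N" by (auto simp: w_def x_def)
  have extend: "(\<Sum>l<N. f l) = (\<Sum>l<n. f l)" if "\<And>l. l \<ge> n \<Longrightarrow> f l = 0" for f :: "nat \<Rightarrow> real"
    using that assms(4) by (intro sum.mono_neutral_right) auto
  have norm_w: "l2_norm (x - w - x) = sqrt V"
  proof -
    have "(\<Sum>l<N. ((x - w - x) $ l)\<^sup>2) = (\<Sum>l<n. ((if l < n then v l else 0))\<^sup>2)"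
      by (subst extend[symmetric]) (auto simp: x_def w_def intro!: sum.cong)
    then show ?thesis by (simp add: l2_norm_def L2_set_def V_def x_def)
  qed
  have norm_rest: "l2_norm (x - w) = sqrt (V - (v j)\<^sup>2)"
  proof -
    have "(\<Sum>l<N. ((x - w) $ l)\<^sup>2) = (\<Sum>l<N. if l = j then 0 else if l < n then (v l)\<^sup>2 else 0)"
      using j by (intro sum.cong) (auto simp: x_def w_def)
    also have "\<dots> = (\<Sum>l<n. if l = j then 0 else (v l)\<^sup>2)"
      using j by (subst extend) (auto intro!: sum.cong)
    also have "\<dots> = (\<Sum>l\<in>{..<n} - {j}. (v l)\<^sup>2)"
      by (intro sum.mono_neutral_cong_right) auto
    also have "\<dots> = V - (v j)\<^sup>2"
      using j by (simp add: V_def sum_diff1)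
    finally show ?thesis by (simp add: l2_norm_def L2_set_def w_def)
  qed
  \<comment> \<open>Outside entry \<open>j\<close> lies at most the fraction m/n of
    \<open>V\<close>, and this fraction is below 1/C squared.\<close>
  have "C\<^sup>2 * (V - (v j)\<^sup>2) < V"
  proof -
    have "real n * (C\<^sup>2 * (V - (v j)\<^sup>2)) \<le> C\<^sup>2 * real m * V"
      using mult_left_mono[OF conc, of "C\<^sup>2"] by (simp add: V_def mult_ac)
    also have "\<dots> < real n * V"
      using assms(3) pos by (simp add: V_def)
    finally show ?thesis using assms(2) by (simp add: mult_less_cancel_left)
  qed
  then have "sqrt (C\<^sup>2 * (V - (v j)\<^sup>2)) < sqrt V" by simp
  then have "C * l2_norm (x - w) < l2_norm (x - w - x)"
    using assms(1) by (simp add: norm_w norm_rest real_sqrt_mult)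
  moreover have "sparse 1 x"
  proof -
    have "{i. i < dim_vec x \<and> x $ i \<noteq> 0} \<subseteq> {j}"
      by (auto simp: x_def split: if_splits)
    then have "card {i. i < dim_vec x \<and> x $ i \<noteq> 0} \<le> card {j}" by (intro card_mono) auto
    then show ?thesis by (simp add: sparse_def)
  qed
  moreover have "\<Phi> *\<^sub>v x = \<Phi> *\<^sub>v (x - w)"
    if \<Phi>: "\<Phi> \<in> carrier_mat m N" and D: "\<forall>i<m. \<forall>j<n. \<Phi> $$ (i, j) = D (i, j)" for \<Phi>
  proof -
    have "\<Phi> *\<^sub>v w = 0\<^sub>v m"
    proof (rule eq_vecI)
      fix i assume "i < dim_vec (0\<^sub>v m :: real vec)"
      then have i: "i < m" by simp
      have "(\<Phi> *\<^sub>v w) $ i = (\<Sum>l<N. \<Phi> $$ (i, l) * (if l < n then v l else 0))"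
        using \<Phi> i by (auto simp: scalar_prod_def w_def atLeast0LessThan intro!: sum.cong)
      also have "\<dots> = (\<Sum>l<n. D (i, l) * v l)"
        using D i by (subst extend) (auto intro!: sum.cong)
      finally show "(\<Phi> *\<^sub>v w) $ i = 0\<^sub>v m $ i" using i ker by simp
    qed (use \<Phi> in simp)
    then show ?thesis
      using \<Phi> mult_minus_distrib_mat_vec[OF \<Phi>, of x w] by simp
  qed
  ultimately show ?thesis
    by (intro exI[of _ x] exI[of _ "x - w"]) auto
qed

section \<open>Consequences of the error guarantee\<close>

text \<open>A sparse signal competes with itself as approximation, so the allowed error is
  0.\<close>

lemma guarantee_sparse_imp_eq:
  assumes "l2_l2_guarantee C k x x'" "sparse k x" "0 \<le> C" "x' \<in> carrier_vec (dim_vec x)"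
  shows "x' = x"
proof -
  obtain y where y: "best_sparse_approx k x y" "l2_norm (x - x') \<le> C * l2_norm (x - y)"
    using assms(1) by (auto simp: l2_l2_guarantee_def)
  have "l2_norm (x - y) \<le> l2_norm (x - x)"
    using y(1) assms(2) by (auto simp: best_sparse_approx_def)
  also have "\<dots> = 0" by (simp add: l2_norm_def L2_set_def)
  finally have "C * l2_norm (x - y) \<le> 0"
    using assms(3) by (simp add: mult_nonneg_nonpos)
  with y(2) have "l2_norm (x - x') \<le> 0" by linarith
  then have "L2_set (\<lambda>i. (x - x') $ i) {..<dim_vec x} = 0"
    using assms(4) by (simp add: l2_norm_def antisym L2_set_nonneg)
  then show ?thesis
    using assms(4) by (intro eq_vecI) (auto simp: L2_set_eq_0_iff)
qed

text \<open>The zero vector is a sparse competitor at distance \<open>l2_norm x\<close>.\<close>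

lemma guarantee_imp_le_norm:
  assumes "l2_l2_guarantee C k x x'" "0 \<le> C"
  shows "l2_norm (x - x') \<le> C * l2_norm x"
proof -
  obtain y where y: "best_sparse_approx k x y" "l2_norm (x - x') \<le> C * l2_norm (x - y)"
    using assms(1) by (auto simp: l2_l2_guarantee_def)
  have "sparse k (0\<^sub>v (dim_vec x))"
    by (simp add: sparse_def cong: conj_cong)
  with y(1) have "l2_norm (x - y) \<le> l2_norm (x - 0\<^sub>v (dim_vec x))"
    by (auto simp: best_sparse_approx_def)
  also have "x - 0\<^sub>v (dim_vec x) = x" by (intro eq_vecI) auto
  finally show ?thesis
    using y(2) assms(2) by (meson mult_left_mono order_trans)
qed

section \<open>Counting bits and constructing the adversary\<close>

text \<open>The signals in \<open>F\<close> can be numbered by words of \<open>s\<close> bits: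
  \<open>M1\<close> sends the number and \<open>M2\<close> looks the signal up.\<close>

lemma info_bounded_adversary_of_card:
  assumes "finite F" "card F \<le> 2 ^ s" "F \<subseteq> carrier_vec N" "\<And>\<Phi>. \<Phi> \<in> X \<Longrightarrow> f \<Phi> \<in> F"
  shows "\<exists>M. info_bounded_adversary m N s M \<and> (\<forall>\<Phi>\<in>X. M \<Phi> = f \<Phi>)"
proof -
  let ?W = "{w :: bool list. set w \<subseteq> UNIV \<and> length w = s}"
  have "card F \<le> card ?W"
    using assms(2) by (subst card_lists_length_eq) auto
  then obtain g where g: "inj_on g F" "g ` F \<subseteq> ?W"
    using card_le_inj[OF assms(1) finite_lists_length_eq[OF finite]] by blast
  define M1 where "M1 \<Phi> = (if f \<Phi> \<in> F then g (f \<Phi>) else [])" for \<Phi>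
  define M2 where "M2 w = (if w \<in> g ` F then inv_into F g w else 0\<^sub>v N)" for w
  have "info_bounded_adversary m N s (M2 \<circ> M1)"
    unfolding info_bounded_adversary_def
  proof (intro exI conjI ballI allI)
    show "length (M1 \<Phi>) \<le> s" for \<Phi> using g(2) by (auto simp: M1_def)
    show "M2 w \<in> carrier_vec N" for w
      using assms(3) inv_into_into[of w g F] by (auto simp: M2_def)
  qed auto
  moreover have "(M2 \<circ> M1) \<Phi> = f \<Phi>" if "\<Phi> \<in> X" for \<Phi>
    using assms(4)[OF that] g(1) by (simp add: M1_def M2_def)
  ultimately show ?thesis by blast
qed

text \<open>Counting shorter words too gives fewer than 2^(b+1) words; the cruder 2^(2b) is easy to
  raise to the power \<open>m * n\<close>.\<close>

lemma card_bool_lists_le: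
  "finite {w :: bool list. length w \<le> b}" "1 \<le> b \<Longrightarrow> card {w :: bool list. length w \<le> b} \<le> 2 ^ (2 * b)"
proof -
  show "finite {w :: bool list. length w \<le> b}"
    using finite_lists_length_le[of "UNIV :: bool set" b] by simp
  assume "1 \<le> b"
  have "card {w :: bool list. length w \<le> b} = (\<Sum>i\<le>b. 2 ^ i)"
    using card_lists_length_le[of "UNIV :: bool set" b] by simp
  also have "\<dots> < 2 ^ Suc b"
    by (induction b) auto
  also have "\<dots> \<le> 2 ^ (2 * b)"
    using \<open>1 \<le> b\<close> by (intro power_increasing) auto
  finally show "card {w :: bool list. length w \<le> b} \<le> 2 ^ (2 * b)" by simp
qed

text \<open>The first \<open>n\<close> columns take at most 2^(2bmn) values, and one more bit
  selects the signal from the pair; this is the budget required of \<open>s\<close>.\<close>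

lemma defeating_adversary:
  fixes C :: real
  assumes "0 < C" "m < n" "C\<^sup>2 * real m < real n" "n \<le> N" "1 \<le> k" "1 \<le> b"
    and scheme: "recovery_scheme m N P A" and bits: "bits_per_entry b P"
    and s: "2 * b * (m * n) + 1 \<le> s"
  shows "\<exists>M. info_bounded_adversary m N s M \<and>
     (\<forall>\<Phi> \<in> set_pmf P. \<not> l2_l2_guarantee C k (M \<Phi>) (A \<Phi> (\<Phi> *\<^sub>v M \<Phi>)))"
proof -
  obtain x x' where xx': "\<And>D. x D \<in> carrier_vec N" "\<And>D. x' D \<in> carrier_vec N" "\<And>D. sparse 1 (x D)"
    "\<And>D. C * l2_norm (x' D) < l2_norm (x' D - x D)"
    "\<And>D \<Phi>. \<Phi> \<in> carrier_mat m N \<Longrightarrow> (\<forall>i<m. \<forall>j<n. \<Phi> $$ (i, j) = D (i, j)) \<Longrightarrow>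
        \<Phi> *\<^sub>v x D = \<Phi> *\<^sub>v x' D"
    using indistinguishable_signals[OF assms(1-4)] by metis
  obtain enc :: "bool list \<Rightarrow> real" where enc: "\<forall>\<Phi> \<in> set_pmf P. \<forall>i < dim_row \<Phi>. \<forall>j < dim_col \<Phi>.
      \<exists>w. length w \<le> b \<and> \<Phi> $$ (i, j) = enc w"
    using bits unfolding bits_per_entry_def ..
  have carrier: "\<Phi> \<in> carrier_mat m N" if "\<Phi> \<in> set_pmf P" for \<Phi>
    using scheme that by (auto simp: recovery_scheme_def)
  define E where "E = enc ` {w. length w \<le> b}"
  define G where "G = ({..<m} \<times> {..<n}) \<rightarrow>\<^sub>E E"
  define sig where "sig = (\<lambda>(D, c). if c then x D else x' D)"
  define F where "F = sig ` (G \<times> UNIV)"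
  define sub where "sub \<Phi> = restrict (\<lambda>ij. \<Phi> $$ ij) ({..<m} \<times> {..<n})" for \<Phi> :: "real mat"
  \<comment> \<open>The Boolean is the extra bit: \<open>x\<close> is sent if the decoder fails on
    it, otherwise \<open>x'\<close>.\<close>
  define f where "f \<Phi> = sig (sub \<Phi>, \<not> l2_l2_guarantee C k (x (sub \<Phi>)) (A \<Phi> (\<Phi> *\<^sub>v x (sub \<Phi>))))" for \<Phi>
  have E: "finite E" "card E \<le> 2 ^ (2 * b)"
    using card_bool_lists_le[of b] assms(6) card_image_le[of "{w. length w \<le> b}" enc]
    by (auto simp: E_def intro: order_trans)
  have G: "finite G" "card G \<le> 2 ^ (2 * b * (m * n))"
    using E power_mono[OF E(2), of "m * n"]
    by (auto simp: G_def card_PiE finite_PiE power_mult)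
  have "finite F" using G by (auto simp: F_def)
  moreover have "card F \<le> 2 ^ s"
  proof -
    have "card F \<le> card (G \<times> (UNIV :: bool set))"
      unfolding F_def using G by (intro card_image_le) auto
    also have "\<dots> \<le> 2 ^ (2 * b * (m * n) + 1)"
      using G by (simp add: card_cartesian_product)
    also have "\<dots> \<le> 2 ^ s"
      using s by (intro power_increasing) auto
    finally show ?thesis .
  qed
  moreover have "F \<subseteq> carrier_vec N"
    using xx'(1,2) by (auto simp: F_def sig_def)
  moreover have "f \<Phi> \<in> F" if "\<Phi> \<in> set_pmf P" for \<Phi>
  proof -
    have "\<Phi> $$ (i, j) \<in> E" if "i < m" "j < n" for i j
    proof -
      have "i < dim_row \<Phi>" "j < dim_col \<Phi>"
        using carrier[OF \<open>\<Phi> \<in> set_pmf P\<close>] that assms(4) by auto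
      with enc \<open>\<Phi> \<in> set_pmf P\<close> obtain w where "length w \<le> b" "\<Phi> $$ (i, j) = enc w"
        by blast
      then show ?thesis by (simp add: E_def)
    qed
    then have "sub \<Phi> \<in> G"
      unfolding sub_def G_def by (intro restrict_PiE_iff[THEN iffD2]) auto
    then show ?thesis
      unfolding f_def F_def by (intro imageI) simp
  qed
  ultimately obtain M where M: "info_bounded_adversary m N s M" "\<And>\<Phi>. \<Phi> \<in> set_pmf P \<Longrightarrow> M \<Phi> = f \<Phi>"
    using info_bounded_adversary_of_card[of F s N "set_pmf P" f m] by blast
  have "\<not> l2_l2_guarantee C k (M \<Phi>) (A \<Phi> (\<Phi> *\<^sub>v M \<Phi>))" if \<Phi>: "\<Phi> \<in> set_pmf P" for \<Phi>
  proof (cases "l2_l2_guarantee C k (x (sub \<Phi>)) (A \<Phi> (\<Phi> *\<^sub>v x (sub \<Phi>)))")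
    case False
    then show ?thesis using M(2)[OF \<Phi>] by (simp add: f_def sig_def)
  next
    case True
    let ?x = "x (sub \<Phi>)" and ?x' = "x' (sub \<Phi>)"
    have "sparse k ?x" using xx'(3)[of "sub \<Phi>"] assms(5) by (simp add: sparse_def)
    moreover have "\<Phi> *\<^sub>v ?x \<in> carrier_vec m"
      using carrier[OF \<Phi>] xx'(1) by (rule mult_mat_vec_carrier)
    then have "A \<Phi> (\<Phi> *\<^sub>v ?x) \<in> carrier_vec (dim_vec ?x)"
      using scheme carrier[OF \<Phi>] xx'(1)[of "sub \<Phi>"] by (auto simp: recovery_scheme_def)
    ultimately have dec: "A \<Phi> (\<Phi> *\<^sub>v ?x) = ?x"
      using guarantee_sparse_imp_eq[OF True] assms(1) by simp
    have "\<Phi> *\<^sub>v ?x = \<Phi> *\<^sub>v ?x'"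
      using xx'(5)[OF carrier[OF \<Phi>]] by (simp add: sub_def)
    with dec have "A \<Phi> (\<Phi> *\<^sub>v ?x') = ?x" by simp
    moreover have "M \<Phi> = ?x'"
      using M(2)[OF \<Phi>] True by (simp add: f_def sig_def)
    \<comment> \<open>The guarantee would bound the distance from \<open>x'\<close> to
      \<open>x\<close> by \<open>C * l2_norm x'\<close>, against the choice of the pair.\<close>
    moreover have "\<not> l2_l2_guarantee C k ?x' ?x"
      using guarantee_imp_le_norm[of C k ?x' ?x] xx'(4)[of "sub \<Phi>"] assms(1) by linarith
    ultimately show ?thesis by simp
  qed
  with M(1) show ?thesis by blast
qed

section \<open>The constant and the lower bound\<close>

theorem theorem3p5:
  fixes C p :: real
  assumes "0 < C" and "0 < p" and "p \<le> 1"
  shows "\<exists>c > 0. \<forall>(m :: nat) (N :: nat) (k :: nat) (s :: nat) (b :: nat) P A.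
    1 \<le> k \<longrightarrow> 1 \<le> b \<longrightarrow> sqrt (real s / real b) \<le> real N \<longrightarrow>
    recovery_scheme m N P A \<longrightarrow> bits_per_entry b P \<longrightarrow>
    (\<forall>M. info_bounded_adversary m N s M \<longrightarrow> successful_against C k p P A M) \<longrightarrow>
    c * sqrt (real s / real b) \<le> real m"
proof -
  \<comment> \<open>The bound 1/8 leaves room for the bit budget and yields \<open>m < n\<close>;
    the other bound yields the condition relating \<open>C\<close>, \<open>m\<close> and
    \<open>n\<close>.\<close>
  define c where "c = min (1 / 8) (1 / C\<^sup>2)"
  have c: "0 < c" "c \<le> 1 / 8" "C\<^sup>2 * c \<le> 1"
    using assms(1) by (auto simp: c_def min_def field_simps)
  have "c * sqrt (real s / real b) \<le> real m"
    if k: "1 \<le> k" and b: "1 \<le> b" and N: "sqrt (real s / real b) \<le> real N"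
      and scheme: "recovery_scheme m N P A" and bits: "bits_per_entry b P"
      and succ: "\<forall>M. info_bounded_adversary m N s M \<longrightarrow> successful_against C k p P A M"
    for m N k s b P A
  proof (rule ccontr)
    define r where "r = sqrt (real s / real b)"
    define n where "n = nat \<lceil>r\<rceil>"
    assume "\<not> ?thesis"
    then have m: "real m < c * r" by (simp add: r_def)
    then have "0 < c * r" by (meson le_less_trans of_nat_0_le_iff)
    with c have "0 < r" by (simp add: zero_less_mult_iff)
    have r2: "r\<^sup>2 * real b = real s" using b by (simp add: r_def)
    have n: "r \<le> real n" "real n < r + 1" using \<open>0 < r\<close> by (auto simp: n_def) linarith+
    have "n \<le> N" using N by (simp add: n_def r_def nat_le_iff ceiling_le_iff)
    have "c * r \<le> 1 / 8 * r" using c \<open>0 < r\<close> by (intro mult_right_mono) auto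
    with m n \<open>0 < r\<close> have "m < n" by linarith
    have "C\<^sup>2 * real m < C\<^sup>2 * (c * r)" using m assms(1) by simp
    also have "\<dots> \<le> 1 * r"
      unfolding mult.assoc[symmetric] using c \<open>0 < r\<close> by (intro mult_right_mono) auto
    finally have "C\<^sup>2 * real m < real n" using n by simp
    have "2 * b * (m * n) + 1 \<le> s"
    proof (cases "m = 0")
      \<comment> \<open>Without rows the budget is just \<open>1 \<le> s\<close>, which follows from
        \<open>0 < r\<close>.\<close>
      case True
      have "0 < r\<^sup>2 * real b" using \<open>0 < r\<close> b by simp
      with True show ?thesis by (simp add: r2)
    next
      case False
      \<comment> \<open>From m at least 1 and m < r/8. Now n < r + 1 is at most 2r, so 2bmn is at
        most s/2, and s is at least 64, which absorbs the extra bit.\<close>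
      then have "8 \<le> r" using m \<open>c * r \<le> 1 / 8 * r\<close> by linarith
      then have "real m * real n \<le> (1 / 8 * r) * (2 * r)"
        using m n \<open>c * r \<le> 1 / 8 * r\<close> by (intro mult_mono) linarith+
      then have "2 * real b * (real m * real n) \<le> 2 * real b * (r\<^sup>2 / 4)"
        by (intro mult_left_mono) (auto simp: power2_eq_square)
      also have "\<dots> = real s / 2" by (simp flip: r2)
      finally have "2 * real b * (real m * real n) \<le> real s / 2" .
      moreover have "8\<^sup>2 * 1 \<le> r\<^sup>2 * real b"
        using \<open>8 \<le> r\<close> b by (intro mult_mono power_mono) auto
      ultimately have "real (2 * b * (m * n) + 1) \<le> real s" by (simp add: r2)
      then show ?thesis by linarith
    qed
    then obtain M where "info_bounded_adversary m N s M"
      and fails: "\<forall>\<Phi> \<in> set_pmf P. \<not> l2_l2_guarantee C k (M \<Phi>) (A \<Phi> (\<Phi> *\<^sub>v M \<Phi>))"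
      using defeating_adversary[OF assms(1) \<open>m < n\<close> \<open>C\<^sup>2 * real m < real n\<close> \<open>n \<le> N\<close> k b scheme bits]
      by blast
    with succ have "p \<le> measure_pmf.prob P {\<Phi>. l2_l2_guarantee C k (M \<Phi>) (A \<Phi> (\<Phi> *\<^sub>v M \<Phi>))}"
      by (auto simp: successful_against_def)
    \<comment> \<open>The decoder fails on the whole support of \<open>P\<close>, so any positive
      \<open>p\<close> is out of reach.\<close>
    also have "\<dots> = 0"
      using fails by (subst measure_pmf_zero_iff) auto
    finally show False using assms(2) by simp
  qed
  with c(1) show ?thesis by blast
qed

end
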